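(* Let $4 \le p \le q$ and let $D$ be a strong orientation of $K(3,p,q)$ with diameter two, with parts $V_1=\{x_1,x_2,x_3\}$, $V_2$ ($|V_2|=p$), $V_3$ ($|V_3|=q$). If exactly four of the eight sets $V_2^A$ ($A \subseteq \{1,2,3\}$) are nonempty, then $$q \le \max\left\{1 + 2\binom{p-2}{\lfloor \frac{p-2}{2} \rfloor} + \binom{p-1}{\lfloor \frac{p-1}{2} \rfloor},\ 2 + 2\binom{p-1}{\lfloor \frac{p-1}{2} \rfloor}\right\}.$$
   Context: $K(3,p,q)$ is the complete tripartite graph with parts $V_1=\{x_1,x_2,x_3\}$, $V_2$ of size $p$, $V_3$ of size $q$. A strong orientation is an orientation of all edges making the digraph strongly connected; its diameter is the maximum directed distance between ordered pairs of vertices. Write $u\to v$ if the edge $uv$ is oriented from $u$ to $v$. For $A \subseteq [3]=\{1,2,3\}$, let $N_D^A$ be the set of vertices $w$ such that $x_i \to w$ for all $i \in A$ and $w \to x_j$ for all $j \in [3]\setminus A$, and $V_2^A = V_2 \cap N_D^A$. The eight sets $V_2^A$ partition $V_2$. *)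

theory Defs
  imports "Graph_Theory.Graph_Theory"
begin

text \<open>
  Following \<^theory>\<open>Graph_Theory.Digraph\<close>, an undirected graph is a symmetric digraph:
  every edge is represented by its two opposite arcs.
\<close>

definition complete_tripartite :: "'a set \<Rightarrow> 'a set \<Rightarrow> 'a set \<Rightarrow> 'a pair_pre_digraph" where
  "complete_tripartite V1 V2 V3 =
     \<lparr> pverts = V1 \<union> V2 \<union> V3,
       parcs = V1 \<times> V2 \<union> V2 \<times> V1 \<union> V1 \<times> V3 \<union> V3 \<times> V1 \<union> V2 \<times> V3 \<union> V3 \<times> V2 \<rparr>"

text \<open>An orientation keeps exactly one of the two opposite arcs of every edge.\<close>

definition orientation_of :: "'a pair_pre_digraph \<Rightarrow> 'a pair_pre_digraph \<Rightarrow> bool" where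
  "orientation_of D G \<longleftrightarrow>
     pverts D = pverts G \<and> parcs D \<subseteq> parcs G \<and>
     (\<forall>(u, v) \<in> parcs G. (u, v) \<in> parcs D \<longleftrightarrow> (v, u) \<notin> parcs D)"

text \<open>
  The distance is the infimum of the costs of all walks for unit arc weights; it is \<open>\<infinity>\<close> if
  there is no walk. On a finite nonempty vertex set the supremum below is a maximum.
\<close>

definition digraph_dist :: "'a pair_pre_digraph \<Rightarrow> 'a \<Rightarrow> 'a \<Rightarrow> ereal" where
  "digraph_dist D u v = wf_digraph.\<mu> (with_proj D) (\<lambda>_. 1) u v"

definition digraph_diameter :: "'a pair_pre_digraph \<Rightarrow> ereal" where
  "digraph_diameter D = (SUP (u, v) \<in> pverts D \<times> pverts D. digraph_dist D u v)"

text \<open>The set $N_D^A$, where \<open>x 1\<close>, \<open>x 2\<close>, \<open>x 3\<close> are the vertices of the first part.\<close>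

definition nbr_class :: "'a pair_pre_digraph \<Rightarrow> (nat \<Rightarrow> 'a) \<Rightarrow> nat set \<Rightarrow> 'a set" where
  "nbr_class D x A =
     {w \<in> pverts D. (\<forall>i \<in> A. x i \<rightarrow>\<^bsub>with_proj D\<^esub> w) \<and>
                    (\<forall>j \<in> {1, 2, 3} - A. w \<rightarrow>\<^bsub>with_proj D\<^esub> x j)}"

end

theory Submission
  imports Defs
begin

text \<open>
  Give every vertex \<open>w\<close> outside \<open>V1\<close> the type \<open>{i. x i \<rightarrow> w}\<close>. For \<open>v \<in> V2\<close> and \<open>w \<in> V3\<close>,
  diameter two leaves only \<open>w \<rightarrow> v\<close> if the type of \<open>v\<close> is contained in that of \<open>w\<close>, and only
  \<open>v \<rightarrow> w\<close> if it contains it. Hence no type occurs in both \<open>V2\<close> and \<open>V3\<close>, and the vertices of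
  \<open>V3\<close> of a given type \<open>B\<close> are separated by their out-neighbours in \<open>V2\<close> of types incomparable
  to \<open>B\<close>; these out-neighbourhoods form an antichain, whose size Sperner's theorem bounds by a
  central binomial coefficient. Summing over the four types \<open>B\<close> that do not occur in \<open>V2\<close>,
  and distinguishing how many of the two trivial types \<open>{}\<close> and \<open>{1, 2, 3}\<close> occur in \<open>V2\<close>,
  gives the bound.
\<close>

section \<open>Central binomial coefficients\<close>

abbreviation (input) central_binomial :: "nat \<Rightarrow> nat" where
  "central_binomial n \<equiv> n choose (n div 2)"

lemma central_binomial_mono:
  assumes "m \<le> n"
  shows "central_binomial m \<le> central_binomial n"
  using binomial_right_mono[OF assms, of "m div 2"] binomial_maximum[of n "m div 2"] by linarith

text \<open>Pascal's rule twice: the right side contains \<open>m choose (m div 2)\<close> once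
  directly and once inside \<open>Suc m choose (m div 2)\<close>.\<close>

lemma double_central_binomial_le: "2 * central_binomial m \<le> central_binomial (m + 2)"
proof -
  have "m choose (m div 2) \<le> Suc m choose (m div 2)"
    by (intro binomial_right_mono) simp
  then show ?thesis by simp
qed

section \<open>Sperner's theorem\<close>

definition antichain :: "'a set set \<Rightarrow> bool" where
  "antichain F \<longleftrightarrow> (\<forall>A\<in>F. \<forall>B\<in>F. A \<subseteq> B \<longrightarrow> A = B)"

text \<open>
  Induction on \<open>S\<close>: apply the hypothesis to the members of \<open>F\<close> that avoid \<open>x\<close>, and sum
  over all \<open>x \<in> S\<close>; a member \<open>A \<noteq> S\<close> is then counted \<open>card S - card A\<close> times.
\<close>

lemma lubell_yamamoto_meshalkin:
  assumes "finite S" "F \<subseteq> Pow S" "antichain F"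
  shows "(\<Sum>A\<in>F. 1 / real (card S choose card A)) \<le> 1"
  using assms
proof (induction "card S" arbitrary: S F)
  case 0
  then have "F = {} \<or> F = {{}}" by auto
  with 0 show ?case by auto
next
  case (Suc n)
  have fF: "finite F" using Suc.prems by (meson finite_Pow_iff finite_subset)
  \<comment> \<open>The member \<open>S\<close> avoids no point, so the averaging would not see it;
    but an antichain containing \<open>S\<close> is \<open>{S}\<close>.\<close>
  show ?case
  proof (cases "S \<in> F")
    case True
    moreover have "A = S" if "A \<in> F" for A
      using True Suc.prems(2,3) that by (meson PowD antichain_def subsetD)
    ultimately have "F = {S}" by blast
    then show ?thesis by simp
  next
    case False
    have avoid: "(\<Sum>A | A \<in> F \<and> x \<notin> A. 1 / real (n choose card A)) \<le> 1" if "x \<in> S" for x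
    proof -
      have "card (S - {x}) = n" using Suc that by simp
      moreover have "antichain {A \<in> F. x \<notin> A}"
        using Suc.prems by (auto simp: antichain_def)
      moreover have "{A \<in> F. x \<notin> A} \<subseteq> Pow (S - {x})" using Suc.prems by auto
      ultimately show ?thesis
        using Suc.hyps(1)[of "S - {x}" "{A \<in> F. x \<notin> A}"] Suc.prems(1) by simp
    qed
    have weight: "(\<Sum>x\<in>S. if x \<notin> A then 1 / real (n choose card A) else 0)
        = real (Suc n) * (1 / real (card S choose card A))" if "A \<in> F" for A
    proof -
      have AS: "A \<subset> S" using that False Suc.prems by auto
      have lt: "card A < Suc n" using psubset_card_mono[OF Suc.prems(1) AS] Suc.hyps by simp
      have "(\<Sum>x\<in>S. if x \<notin> A then 1 / real (n choose card A) else 0)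
          = (\<Sum>x\<in>S - A. 1 / real (n choose card A))"
        using Suc.prems(1) by (intro sum.mono_neutral_cong_right) auto
      also have "\<dots> = real (Suc n - card A) / real (n choose card A)"
        using AS Suc.hyps(2) finite_subset[of A S] Suc.prems(1) by (simp add: card_Diff_subset)
      also have "\<dots> = real (Suc n) * (1 / real (Suc n choose card A))"
      proof -
        \<comment> \<open>Absorption turns the multiplicity of \<open>A\<close> into the factor
          \<open>Suc n\<close>, which is the same for all \<open>A\<close> and cancels at the
          end.\<close>
        have "real (Suc n - card A) * real (Suc n choose card A) = real (Suc n) * real (n choose card A)"
          using binomial_absorb_comp[of "Suc n" "card A"]
          by (metis diff_Suc_1 of_nat_mult)
        moreover have "0 < n choose card A" "0 < Suc n choose card A"
          using lt by (simp_all only: zero_less_binomial_iff)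
        ultimately show ?thesis by (simp add: field_simps del: of_nat_Suc binomial_Suc_Suc)
      qed
      finally show ?thesis using Suc.hyps(2) by simp
    qed
    have "real (Suc n) * (\<Sum>A\<in>F. 1 / real (card S choose card A))
        = (\<Sum>A\<in>F. \<Sum>x\<in>S. if x \<notin> A then 1 / real (n choose card A) else 0)"
      unfolding sum_distrib_left by (intro sum.cong refl weight[symmetric])
    also have "\<dots> = (\<Sum>x\<in>S. \<Sum>A | A \<in> F \<and> x \<notin> A. 1 / real (n choose card A))"
      by (subst sum.swap) (simp add: sum.inter_filter[OF fF])
    also have "\<dots> \<le> (\<Sum>x\<in>S. 1)" by (intro sum_mono avoid)
    also have "\<dots> = real (Suc n)" using Suc.hyps(2) by simp
    finally show ?thesis by (simp add: mult_le_cancel_left1)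
  qed
qed

text \<open>The central coefficient is the largest, so every summand of the preceding inequality is
  at least its reciprocal.\<close>

theorem sperner:
  assumes "finite S" "F \<subseteq> Pow S" "antichain F"
  shows "card F \<le> central_binomial (card S)"
proof -
  let ?M = "real (central_binomial (card S))"
  have M: "?M > 0" by (simp add: zero_less_binomial_iff)
  have "real (card F) * (1 / ?M) = (\<Sum>A\<in>F. 1 / ?M)" by simp
  also have "\<dots> \<le> (\<Sum>A\<in>F. 1 / real (card S choose card A))"
  proof (rule sum_mono)
    fix A assume "A \<in> F"
    then have "card A \<le> card S" using assms by (auto intro: card_mono)
    then show "1 / ?M \<le> 1 / real (card S choose card A)"
      by (intro divide_left_mono) (auto simp: binomial_maximum zero_less_binomial_iff)
  qed
  also have "\<dots> \<le> 1" by (rule lubell_yamamoto_meshalkin[OF assms])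
  finally show ?thesis using M by (simp add: field_simps)
qed

section \<open>Incomparable subsets of a three-element set\<close>

definition incomparable :: "'a set \<Rightarrow> 'a set \<Rightarrow> bool" where
  "incomparable A B \<longleftrightarrow> \<not> A \<subseteq> B \<and> \<not> B \<subseteq> A"

definition trivial_types :: "nat set set" where
  "trivial_types = {{}, {1, 2, 3}}"

definition proper_types :: "nat set set" where
  "proper_types = {{1}, {2}, {3}, {1, 2}, {1, 3}, {2, 3}}"

text \<open>Restricting to proper types loses nothing among subsets of \<open>{1, 2, 3}\<close>: the
  trivial types are comparable to all of them.\<close>

definition incomparable_types :: "nat set \<Rightarrow> nat set set" where
  "incomparable_types B = {A \<in> proper_types. incomparable A B}"

lemma Pow_types: "Pow {1, 2, 3} = trivial_types \<union> proper_types"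
  by (auto simp: Pow_insert trivial_types_def proper_types_def)

lemma finite_types [simp]: "finite trivial_types" "finite proper_types"
  by (simp_all add: trivial_types_def proper_types_def)

lemma card_types: "card trivial_types = 2" "card proper_types = 6"
  by (auto simp: trivial_types_def proper_types_def doubleton_eq_iff)

lemma trivial_Int_proper_types: "trivial_types \<inter> proper_types = {}"
proof -
  have "card B \<in> {1, 2}" if "B \<in> proper_types" for B
    using that by (auto simp: proper_types_def)
  then show ?thesis by (fastforce simp: trivial_types_def)
qed

lemma incomparable_types_explicit:
  "incomparable_types {1} = {{2}, {3}, {2, 3}}"
  "incomparable_types {2} = {{1}, {3}, {1, 3}}"
  "incomparable_types {3} = {{1}, {2}, {1, 2}}"
  "incomparable_types {1, 2} = {{3}, {1, 3}, {2, 3}}"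
  "incomparable_types {1, 3} = {{2}, {1, 2}, {2, 3}}"
  "incomparable_types {2, 3} = {{1}, {1, 2}, {1, 3}}"
  unfolding incomparable_types_def incomparable_def proper_types_def by auto

lemma card_incomparable_types:
  assumes "B \<in> proper_types"
  shows "card (incomparable_types B) = 3"
  using assms by (auto simp: proper_types_def incomparable_types_explicit[simplified] doubleton_eq_iff)

text \<open>The singletons incomparable to a proper type \<open>B\<close> are the \<open>{i}\<close>
  with \<open>i \<notin> B\<close>, so \<open>B\<close> can be read off.\<close>

lemma inj_on_incomparable_types: "inj_on incomparable_types proper_types"
proof (rule inj_on_inverseI)
  fix B assume B: "B \<in> proper_types"
  then have "{i} \<in> incomparable_types B \<longleftrightarrow> i \<notin> B" if "i \<in> {1, 2, 3}" for i
    using that by (auto simp: incomparable_types_def incomparable_def proper_types_def)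
  then show "{i \<in> {1, 2, 3}. {i} \<notin> incomparable_types B} = B" using B by (auto simp: proper_types_def)
qed

text \<open>Since \<open>Y \<le> X\<close>, the worst case has as many large terms as
  \<open>k\<close> allows.\<close>

lemma sum_le_two_level:
  fixes f :: "'a \<Rightarrow> nat"
  assumes "finite S" "\<And>x. x \<in> S \<Longrightarrow> f x \<le> X" "\<And>x. x \<in> S - T \<Longrightarrow> f x \<le> Y"
    and "Y \<le> X" "card (S \<inter> T) \<le> k" "k \<le> card S"
  shows "sum f S \<le> k * X + (card S - k) * Y"
proof -
  have "sum f S = sum f (S \<inter> T) + sum f (S - T)"
    using assms(1) by (metis sum.Int_Diff)
  also have "\<dots> \<le> card (S \<inter> T) * X + card (S - T) * Y"
    using sum_bounded_above[of "S \<inter> T" f X] sum_bounded_above[of "S - T" f Y] assms(2,3)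
    by (simp add: add_mono)
  also have "card (S - T) = card S - card (S \<inter> T)"
    using assms(1) by (simp add: card_Diff_subset_Int)
  also have "card (S \<inter> T) * X + (card S - card (S \<inter> T)) * Y \<le> k * X + (card S - k) * Y"
  proof -
    obtain d where d: "k = card (S \<inter> T) + d" using assms(5) le_Suc_ex by blast
    then have "card S - card (S \<inter> T) = (card S - k) + d" using assms(6) by simp
    then show ?thesis using d assms(4) by (simp add: algebra_simps)
  qed
  finally show ?thesis .
qed

section \<open>Counting by types\<close>

text \<open>Isolates the counting from digraphs: \<open>R w v\<close> stands for an arc from
  \<open>w\<close> in \<open>V3\<close> to \<open>v\<close> in \<open>V2\<close>, and the last three
  assumptions carry what diameter two contributes.\<close>

locale type_separation =
  fixes V2 :: "'v set" and V3 :: "'w set"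
    and \<alpha> :: "'v \<Rightarrow> nat set" and \<beta> :: "'w \<Rightarrow> nat set" and R :: "'w \<Rightarrow> 'v \<Rightarrow> bool"
  assumes fin: "finite V2" "finite V3"
    and types: "\<alpha> ` V2 \<subseteq> Pow {1, 2, 3}" "\<beta> ` V3 \<subseteq> Pow {1, 2, 3}"
    and four: "card (\<alpha> ` V2) = 4"
    and forced: "v \<in> V2 \<Longrightarrow> w \<in> V3 \<Longrightarrow> \<alpha> v \<subseteq> \<beta> w \<Longrightarrow> R w v"
    and forbidden: "v \<in> V2 \<Longrightarrow> w \<in> V3 \<Longrightarrow> \<beta> w \<subseteq> \<alpha> v \<Longrightarrow> \<not> R w v"
    and separated: "w \<in> V3 \<Longrightarrow> w' \<in> V3 \<Longrightarrow> w \<noteq> w' \<Longrightarrow> \<beta> w = \<beta> w' \<Longrightarrow> \<exists>v\<in>V2. R w v \<and> \<not> R w' v"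
begin

definition fibre :: "nat set \<Rightarrow> 'w set" where
  "fibre B = {w \<in> V3. \<beta> w = B}"

text \<open>The vertices of \<open>V2\<close> whose arc to a vertex of type \<open>B\<close> is not
  determined by the types.\<close>

definition free :: "nat set \<Rightarrow> 'v set" where
  "free B = {v \<in> V2. incomparable (\<alpha> v) B}"

lemma card_fibre_le: "card (fibre B) \<le> central_binomial (card (free B))"
proof -
  define out where "out w = {v \<in> free B. R w v}" for w
  have sep: "w = w'" if w: "w \<in> fibre B" "w' \<in> fibre B" "out w \<subseteq> out w'" for w w'
  proof (rule ccontr)
    assume "w \<noteq> w'"
    then obtain v where v: "v \<in> V2" "R w v" "\<not> R w' v"
      using separated[of w w'] w by (auto simp: fibre_def)
    \<comment> \<open>A comparable type of \<open>v\<close> would force \<open>R w' v\<close> or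
      forbid \<open>R w v\<close>.\<close>
    then have "v \<in> free B"
      using forced[of v w'] forbidden[of v w] w by (auto simp: fibre_def free_def incomparable_def)
    then show False using v w by (auto simp: out_def)
  qed
  have "card (fibre B) = card (out ` fibre B)"
    using sep by (intro card_image[symmetric] inj_onI) auto
  also have "\<dots> \<le> central_binomial (card (free B))"
  proof (rule sperner)
    show "antichain (out ` fibre B)" unfolding antichain_def using sep by blast
  qed (use fin in \<open>auto simp: out_def free_def\<close>)
  finally show ?thesis .
qed

text \<open>Each type in \<open>V2\<close> comparable to \<open>B\<close> takes up at least one
  vertex outside \<open>free B\<close>.\<close>

lemma card_free_le: "card (free B) + card {A \<in> \<alpha> ` V2. \<not> incomparable A B} \<le> card V2"
proof -
  have "{A \<in> \<alpha> ` V2. \<not> incomparable A B} = \<alpha> ` (V2 - free B)" by (auto simp: free_def)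
  then have "card {A \<in> \<alpha> ` V2. \<not> incomparable A B} \<le> card (V2 - free B)"
    using fin by (simp add: card_image_le)
  also have "\<dots> = card V2 - card (free B)"
    using fin by (simp add: card_Diff_subset free_def)
  finally show ?thesis using card_mono[of V2 "free B"] fin by (auto simp: free_def)
qed

lemma fibre_empty: "B \<in> \<alpha> ` V2 \<Longrightarrow> fibre B = {}"
  using forced forbidden by (fastforce simp: fibre_def)

lemma card_fibre_trivial:
  assumes "B \<in> trivial_types"
  shows "card (fibre B) \<le> 1"
proof -
  have "incomparable A B = False" if "A \<in> Pow {1, 2, 3}" for A
    using assms that by (auto simp: incomparable_def trivial_types_def)
  then have "free B = {}" unfolding free_def using types by blast
  then show ?thesis using card_fibre_le[of B] by simp
qed

text \<open>The second assumption says that at least \<open>k\<close> of the four types in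
  \<open>V2\<close> are comparable to \<open>B\<close>; each of them costs one free vertex.\<close>

lemma card_fibre_proper:
  assumes "B \<in> proper_types"
    and "card (\<alpha> ` V2 \<inter> incomparable_types B) + k \<le> 4"
  shows "card (fibre B) \<le> central_binomial (card V2 - k)"
proof -
  have "{A \<in> \<alpha> ` V2. \<not> incomparable A B} = \<alpha> ` V2 - incomparable_types B"
  proof -
    have "A \<in> incomparable_types B \<longleftrightarrow> incomparable A B" if "A \<in> \<alpha> ` V2" for A
    proof -
      have "A \<in> trivial_types \<union> proper_types" using subsetD[OF types(1) that] unfolding Pow_types .
      moreover have "\<not> incomparable A B" if "A \<in> trivial_types"
        using that assms(1) by (auto simp: incomparable_def trivial_types_def proper_types_def)
      ultimately show ?thesis by (auto simp: incomparable_types_def)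
    qed
    then show ?thesis by blast
  qed
  moreover have "card (\<alpha> ` V2 - incomparable_types B) = 4 - card (\<alpha> ` V2 \<inter> incomparable_types B)"
    using fin four by (simp add: card_Diff_subset_Int)
  ultimately have "card {A \<in> \<alpha> ` V2. \<not> incomparable A B} = 4 - card (\<alpha> ` V2 \<inter> incomparable_types B)"
    by simp
  then have "card (free B) \<le> card V2 - k"
    using card_free_le[of B] assms(2) by linarith
  then show ?thesis using card_fibre_le[of B] central_binomial_mono le_trans by blast
qed

lemma card_V3_eq:
  "card V3 = (\<Sum>B\<in>trivial_types - \<alpha> ` V2. card (fibre B)) + (\<Sum>B\<in>proper_types - \<alpha> ` V2. card (fibre B))"
proof -
  have "card V3 = (\<Sum>B\<in>Pow {1, 2, 3}. card (fibre B))"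
    using sum.group[of V3 "Pow {1, 2, 3}" \<beta> "\<lambda>_. 1 :: nat"] fin types by (simp add: fibre_def)
  also have "\<dots> = (\<Sum>B\<in>(trivial_types - \<alpha> ` V2) \<union> (proper_types - \<alpha> ` V2). card (fibre B))"
    unfolding Pow_types by (rule sum.mono_neutral_right) (use fibre_empty in auto)
  also have "\<dots> = (\<Sum>B\<in>trivial_types - \<alpha> ` V2. card (fibre B)) + (\<Sum>B\<in>proper_types - \<alpha> ` V2. card (fibre B))"
    by (rule sum.union_disjoint) (use trivial_Int_proper_types in auto)
  finally show ?thesis .
qed

text \<open>If \<open>e\<close> trivial types occur in \<open>V2\<close>, then \<open>2 - e\<close>
  trivial and \<open>2 + e\<close> proper types remain for \<open>V3\<close>. A trivial one holds at
  most one vertex; a proper one is bounded according to how many types of \<open>V2\<close> it is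
  comparable to.\<close>

theorem card_V3_le:
  assumes "4 \<le> card V2"
  defines "p \<equiv> card V2"
  shows "card V3 \<le> max (1 + 2 * central_binomial (p - 2) + central_binomial (p - 1))
                         (2 + 2 * central_binomial (p - 1))"
proof -
  let ?A = "\<alpha> ` V2"
  define P where "P = ?A \<inter> proper_types"
  define e where "e = card (?A \<inter> trivial_types)"
  have finP: "finite P" by (simp add: P_def)
  have e: "e \<le> 2" unfolding e_def using card_mono[of trivial_types "?A \<inter> trivial_types"] card_types by simp
  have A_split: "?A = (?A \<inter> trivial_types) \<union> P"
    unfolding P_def using types(1) Pow_types by blast
  have "card ?A = e + card P"
    unfolding e_def by (subst A_split, rule card_Un_disjoint) (use trivial_Int_proper_types in \<open>auto simp: P_def\<close>)
  then have cP: "card P = 4 - e" using four by simp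
  have c_triv: "card (trivial_types - ?A) = 2 - e"
    using card_Diff_subset_Int[of trivial_types ?A] by (simp add: e_def Int_commute card_types)
  have "card (proper_types - ?A) = card proper_types - card P"
    using card_Diff_subset_Int[of proper_types ?A] by (simp add: P_def Int_commute)
  then have c_prop: "card (proper_types - ?A) = 2 + e"
    using card_types cP e by simp
  have triv: "(\<Sum>B\<in>trivial_types - ?A. card (fibre B)) \<le> 2 - e"
    using sum_bounded_above[of "trivial_types - ?A" "\<lambda>B. card (fibre B)" 1] card_fibre_trivial c_triv
    by simp
  have inter: "?A \<inter> incomparable_types B = P \<inter> incomparable_types B" for B
    by (auto simp: P_def incomparable_types_def)
  have fin_I: "finite (incomparable_types B)" for B by (simp add: incomparable_types_def)
  \<comment> \<open>The \<open>e\<close> trivial types are comparable to \<open>B\<close>, and at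
    least one of the four types is, because only three are incomparable to \<open>B\<close>.\<close>
  have prop_all: "card (fibre B) \<le> central_binomial (p - k)"
    if "B \<in> proper_types" "k \<le> e \<or> k \<le> 1" for B k
  proof -
    have "card (P \<inter> incomparable_types B) \<le> card P" "card (P \<inter> incomparable_types B) \<le> 3"
      using card_mono[OF finP, of "P \<inter> incomparable_types B"]
        card_mono[OF fin_I, of "P \<inter> incomparable_types B" B] card_incomparable_types[OF that(1)]
      by auto
    then show ?thesis
      unfolding p_def using card_fibre_proper[OF that(1), of k] that(2) cP e by (auto simp: inter)
  qed
  \<comment> \<open>The types incomparable to every proper type of \<open>V2\<close>; any other
    proper type is comparable to one more than the \<open>e\<close> trivial ones.\<close>
  define T where "T = {B \<in> proper_types. P \<subseteq> incomparable_types B}"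
  have prop_other: "card (fibre B) \<le> central_binomial (p - Suc e)" if "B \<in> proper_types" "B \<notin> T" for B
  proof -
    have "P \<inter> incomparable_types B \<subset> P" using that by (auto simp: T_def)
    then have "card (P \<inter> incomparable_types B) < card P" using finP by (rule psubset_card_mono[rotated])
    then show ?thesis
      unfolding p_def using card_fibre_proper[OF that(1), of "Suc e"] cP e by (simp add: inter)
  qed
  consider "e = 0" | "e = 1" | "e = 2" using e by linarith
  then show ?thesis
  proof cases
    case 1
    have "(\<Sum>B\<in>proper_types - ?A. card (fibre B)) \<le> 2 * central_binomial (p - 1)"
      using sum_bounded_above[of "proper_types - ?A" "\<lambda>B. card (fibre B)" "central_binomial (p - 1)"]
        prop_all[of _ 1] c_prop 1 by simp
    then show ?thesis using card_V3_eq triv 1 by linarith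
  next
    case 2
    \<comment> \<open>Here \<open>P\<close> has three elements, so it equals
      \<open>incomparable_types C\<close> for each \<open>C\<close> in \<open>T\<close>, and this
      determines \<open>C\<close>.\<close>
    have "B = B'" if "B \<in> T" "B' \<in> T" for B B'
    proof -
      have "P = incomparable_types C" if "C \<in> T" for C
        using that cP 2 card_incomparable_types[of C] by (intro card_subset_eq fin_I) (auto simp: T_def)
      then have "incomparable_types B = incomparable_types B'" using that by metis
      then show ?thesis
        using inj_on_incomparable_types that by (auto simp: T_def dest: inj_onD)
    qed
    then have "card T \<le> 1" by (metis card.infinite card_le_Suc0_iff_eq One_nat_def zero_le)
    then have cT: "card ((proper_types - ?A) \<inter> T) \<le> 1"
      using card_mono[of T "(proper_types - ?A) \<inter> T"] by (simp add: T_def)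
    have "(\<Sum>B\<in>proper_types - ?A. card (fibre B))
        \<le> 1 * central_binomial (p - 1) + (card (proper_types - ?A) - 1) * central_binomial (p - 2)"
      using prop_all[of _ 1] prop_other cT c_prop 2
      by (intro sum_le_two_level[where T = T] central_binomial_mono) (auto simp: numeral_2_eq_2)
    then have "card V3 \<le> 1 + 2 * central_binomial (p - 2) + central_binomial (p - 1)"
      using card_V3_eq triv c_prop 2 by simp
    then show ?thesis by (rule max.coboundedI1)
  next
    case 3
    then obtain S S' where S: "P = {S, S'}" "S \<noteq> S'"
      using cP by (auto simp: card_2_iff numeral_2_eq_2[symmetric])
    then have SS: "S \<in> proper_types" "S' \<in> proper_types" by (auto simp: P_def)
    \<comment> \<open>By symmetry of incomparability, \<open>T\<close> lies in two distinct
      three-element sets and so has at most two elements.\<close>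
    have "T \<subseteq> incomparable_types S \<inter> incomparable_types S'"
      unfolding T_def S by (auto simp: incomparable_types_def incomparable_def)
    moreover have "card (incomparable_types S \<inter> incomparable_types S') < 3"
    proof -
      have "incomparable_types S \<noteq> incomparable_types S'"
        using inj_on_incomparable_types SS S(2) by (auto dest: inj_onD)
      then have "incomparable_types S \<inter> incomparable_types S' \<subset> incomparable_types S"
        using card_subset_eq[OF fin_I, of "incomparable_types S" S']
          card_incomparable_types[OF SS(1)] card_incomparable_types[OF SS(2)] by auto
      then show ?thesis
        using psubset_card_mono[OF fin_I] card_incomparable_types[OF SS(1)] by metis
    qed
    ultimately have "card ((proper_types - ?A) \<inter> T) < 3"
      using card_mono[of "incomparable_types S \<inter> incomparable_types S'" "(proper_types - ?A) \<inter> T"] fin_I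
      by (meson finite_Int inf.coboundedI2 le_less_trans)
    then have cT: "card ((proper_types - ?A) \<inter> T) \<le> 2" by simp
    have "(\<Sum>B\<in>proper_types - ?A. card (fibre B))
        \<le> 2 * central_binomial (p - 2) + (card (proper_types - ?A) - 2) * central_binomial (p - 3)"
      using prop_all[of _ 2] prop_other cT c_prop 3
      by (intro sum_le_two_level[where T = T] central_binomial_mono) (auto simp: numeral_2_eq_2 numeral_3_eq_3)
    \<comment> \<open>The four remaining proper types give two terms for \<open>p - 2\<close> and
      two for \<open>p - 3\<close>; the latter two merge into the single term for
      \<open>p - 1\<close>.\<close>
    moreover have "2 * central_binomial (p - 3) \<le> central_binomial (p - 1)"
    proof -
      have "p - 3 + 2 = p - 1" using assms(1) by (simp add: p_def)
      then show ?thesis using double_central_binomial_le[of "p - 3"] by metis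
    qed
    ultimately have "card V3 \<le> 1 + 2 * central_binomial (p - 2) + central_binomial (p - 1)"
      using card_V3_eq triv c_prop 3 by simp
    then show ?thesis by (rule max.coboundedI1)
  qed
qed

end

section \<open>Orientations of diameter two\<close>

text \<open>Walk lengths are integers, so a distance below 3 is realised by a walk of length at most 2.\<close>

lemma digraph_dist_le_2D:
  assumes "wf_digraph (with_proj D)" "digraph_dist D u v \<le> 2" "u \<noteq> v"
  shows "(u, v) \<in> parcs D \<or> (\<exists>z. (u, z) \<in> parcs D \<and> (z, v) \<in> parcs D)"
proof -
  interpret wf_digraph "with_proj D" by fact
  have "digraph_dist D u v < 3" using assms(2) by (rule le_less_trans) simp
  then obtain es where es: "awalk u es v" "ereal (awalk_cost (\<lambda>_. 1) es) < 3"
    unfolding digraph_dist_def \<mu>_def INF_less_iff by auto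
  have "awalk_cost (\<lambda>_. 1) es = real (length es)" by (induction es) auto
  then have "length es < 3" using es(2) by simp
  then consider "es = []" | a where "es = [a]" | a b where "es = [a, b]"
    by (cases es rule: list.exhaust; cases "tl es"; cases "tl (tl es)") auto
  then show ?thesis
    using es(1) assms(3) by cases (auto simp: awalk_Nil_iff awalk_Cons_iff)
qed

theorem theorem4p16:
  fixes D :: "'a pair_pre_digraph"
    and x :: "nat \<Rightarrow> 'a"
    and V2 V3 :: "'a set"
    and p q :: nat
  defines "V1 \<equiv> {x 1, x 2, x 3}"
  assumes "4 \<le> p" and "p \<le> q"
    and "inj_on x {1, 2, 3}"
    and "finite V2" and "card V2 = p"
    and "finite V3" and "card V3 = q"
    and "V1 \<inter> V2 = {}" and "V1 \<inter> V3 = {}" and "V2 \<inter> V3 = {}"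
    and "orientation_of D (complete_tripartite V1 V2 V3)"
    and "strongly_connected (with_proj D)"
    and "digraph_diameter D = 2"
    and "card {A. A \<subseteq> {1, 2, 3} \<and> V2 \<inter> nbr_class D x A \<noteq> {}} = 4"
  shows "q \<le> max (1 + 2 * ((p - 2) choose ((p - 2) div 2)) + ((p - 1) choose ((p - 1) div 2)))
                 (2 + 2 * ((p - 1) choose ((p - 1) div 2)))"
proof -
  define arc where "arc u v \<longleftrightarrow> (u, v) \<in> parcs D" for u v
  define type where "type w = {i \<in> {1, 2, 3}. arc (x i) w}" for w
  define E where "E = V1 \<times> V2 \<union> V2 \<times> V1 \<union> V1 \<times> V3 \<union> V3 \<times> V1 \<union> V2 \<times> V3 \<union> V3 \<times> V2"
  have orient: "pverts D = V1 \<union> V2 \<union> V3" "parcs D \<subseteq> E"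
      "\<forall>(u, v)\<in>E. (u, v) \<in> parcs D \<longleftrightarrow> (v, u) \<notin> parcs D"
    using assms(12) unfolding orientation_of_def complete_tripartite_def E_def by simp_all
  note pverts = orient(1)
  have arcs: "(u, v) \<in> V1 \<times> V2 \<union> V2 \<times> V1 \<union> V1 \<times> V3 \<union> V3 \<times> V1 \<union> V2 \<times> V3 \<union> V3 \<times> V2"
    if "arc u v" for u v
    using orient(2) that unfolding arc_def E_def[symmetric] by (rule subsetD)
  have flip: "arc u v \<longleftrightarrow> \<not> arc v u"
    if "(u, v) \<in> V1 \<times> V2 \<union> V2 \<times> V1 \<union> V1 \<times> V3 \<union> V3 \<times> V1 \<union> V2 \<times> V3 \<union> V3 \<times> V2" for u v
    using bspec[OF orient(3), of "(u, v)"] that unfolding arc_def E_def[symmetric] by simp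
  have ends: "u \<in> V1 \<union> V2 \<union> V3 \<and> v \<in> V1 \<union> V2 \<union> V3" if "arc u v" for u v
    using arcs[OF that] by blast
  then have wf: "wf_digraph (with_proj D)"
    unfolding arc_def pverts[symmetric] by unfold_locales auto
  have indep: "\<not> (u \<in> V2 \<and> v \<in> V2)" "\<not> (u \<in> V3 \<and> v \<in> V3)" if "arc u v" for u v
    using arcs[OF that] assms(9-11) by blast+
  have dist: "digraph_dist D u v \<le> 2" if "u \<in> pverts D" "v \<in> pverts D" for u v
  proof -
    have "(case (u, v) of (u, v) \<Rightarrow> digraph_dist D u v) \<le> digraph_diameter D"
      unfolding digraph_diameter_def by (rule SUP_upper) (use that in simp)
    then show ?thesis unfolding assms(14) by simp
  qed
  have two_step: "arc u v \<or> (\<exists>z. arc u z \<and> arc z v)"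
    if "u \<in> V1 \<union> V2 \<union> V3" "v \<in> V1 \<union> V2 \<union> V3" "u \<noteq> v" for u v
    using digraph_dist_le_2D[OF wf dist[of u v]] that unfolding arc_def pverts by simp
  have V1D: "\<exists>i \<in> {1, 2, 3}. z = x i" if "z \<in> V1" for z using that by (auto simp: V1_def)
  have x_V1: "x i \<in> V1" if "i \<in> {1, 2, 3}" for i using that by (auto simp: V1_def)
  have into_type: "arc (x i) w \<longleftrightarrow> i \<in> type w" "arc w (x i) \<longleftrightarrow> i \<notin> type w"
    if "i \<in> {1, 2, 3}" "w \<in> V2 \<union> V3" for i w
  proof -
    show "arc (x i) w \<longleftrightarrow> i \<in> type w" using that(1) by (simp add: type_def)
    moreover have "arc (x i) w \<longleftrightarrow> \<not> arc w (x i)"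
      by (rule flip) (use that(2) x_V1[OF that(1)] in blast)
    ultimately show "arc w (x i) \<longleftrightarrow> i \<notin> type w" by blast
  qed
  have type_sub: "type w \<subseteq> {1, 2, 3}" for w unfolding type_def by (rule Collect_restrict)
  have nbr: "w \<in> nbr_class D x A \<longleftrightarrow> type w = A" if "w \<in> V2" "A \<subseteq> {1, 2, 3}" for w A
  proof -
    have "w \<in> nbr_class D x A \<longleftrightarrow> (\<forall>i\<in>A. arc (x i) w) \<and> (\<forall>j\<in>{1, 2, 3} - A. arc w (x j))"
      using that pverts by (simp add: nbr_class_def arc_def)
    also have "\<dots> \<longleftrightarrow> (\<forall>i\<in>A. i \<in> type w) \<and> (\<forall>j\<in>{1, 2, 3} - A. j \<notin> type w)"
      by (intro arg_cong2[where f = conj] ball_cong refl into_type) (use that in auto)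
    also have "\<dots> \<longleftrightarrow> type w = A"
    proof -
      have "(\<forall>i\<in>A. i \<in> t) \<and> (\<forall>j\<in>S - A. j \<notin> t) \<longleftrightarrow> t = A" if "t \<subseteq> S" "A \<subseteq> S"
        for t S :: "nat set"
        using that by blast
      from this[OF type_sub that(2)] show ?thesis .
    qed
    finally show ?thesis .
  qed
  have "{A. A \<subseteq> {1, 2, 3} \<and> V2 \<inter> nbr_class D x A \<noteq> {}} = type ` V2"
  proof -
    have "{A. A \<subseteq> S \<and> V2 \<inter> N A \<noteq> {}} = type ` V2"
      if "\<And>w. type w \<subseteq> S" "\<And>w A. w \<in> V2 \<Longrightarrow> A \<subseteq> S \<Longrightarrow> w \<in> N A \<longleftrightarrow> type w = A" for S N
      using that by blast
    from this[OF type_sub nbr] show ?thesis .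
  qed
  then have four: "card (type ` V2) = 4" using assms(15) by simp
  have "type_separation V2 V3 type type arc"
  proof
    fix v w assume vw: "v \<in> V2" "w \<in> V3"
    have ne: "v \<noteq> w" using vw assms(11) by blast
    \<comment> \<open>There are no arcs inside \<open>V2\<close> or inside \<open>V3\<close>, so a
      path of length two between \<open>v\<close> and \<open>w\<close> passes through
      \<open>V1\<close>.\<close>
    have mid: "z \<in> V1" if "arc v z \<and> arc z w \<or> arc w z \<and> arc z v" for z
      using that ends indep vw by (metis Un_iff)
    \<comment> \<open>Otherwise a path from \<open>w\<close> through some \<open>x i\<close> to
      \<open>v\<close> gives \<open>i \<notin> type w\<close> and
      \<open>i \<in> type v\<close>.\<close>
    show "arc w v" if sub: "type v \<subseteq> type w"
    proof (rule ccontr)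
      assume "\<not> arc w v"
      then obtain z where z: "arc w z" "arc z v" using two_step[of w v] vw ne by blast
      then obtain i where "i \<in> {1, 2, 3}" "z = x i" using mid V1D by blast
      then show False using z into_type[of i] vw sub by blast
    qed
    show "\<not> arc w v" if sup: "type w \<subseteq> type v"
    proof
      assume "arc w v"
      then have "\<not> arc v w" using flip[of w v] vw by blast
      then obtain z where z: "arc v z" "arc z w" using two_step[of v w] vw ne by blast
      then obtain i where "i \<in> {1, 2, 3}" "z = x i" using mid V1D by blast
      then show False using z into_type[of i] vw sup by blast
    qed
  next
    fix w w' assume w: "w \<in> V3" "w' \<in> V3" "w \<noteq> w'" "type w = type w'"
    have "\<not> arc w w'" using indep(2) w by blast
    then obtain z where z: "arc w z" "arc z w'" using two_step[of w w'] w by blast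
    \<comment> \<open>A middle vertex \<open>x i\<close> would put \<open>i\<close> in the type of
      \<open>w'\<close> but not in that of \<open>w\<close>.\<close>
    have "z \<notin> V1" using V1D into_type z w by blast
    then have "z \<in> V2" using ends[OF z(1)] indep(2)[OF z(1)] w by blast
    moreover have "\<not> arc w' z" using flip[of w' z] \<open>z \<in> V2\<close> w z by blast
    ultimately show "\<exists>v\<in>V2. arc w v \<and> \<not> arc w' v" using z by blast
  qed (use four assms(5,7) in \<open>auto simp: type_def\<close>)
  from type_separation.card_V3_le[OF this] show ?thesis
    using assms(2,6,8) by simp
qed

end
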